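(* Let $k\ge 1$ be a fixed integer, let $B_k=\{z\in\mathbb{C}^k:\sum_{i=1}^k|z_i|^2<1\}$ and $\partial B_k=\{z\in\mathbb{C}^k:\sum_{i=1}^k|z_i|^2=1\}$, and let $\mu$ be the normalized $U_k$-invariant measure on $\partial B_k$. Let $$K(z,w):=\frac{1}{1-\langle z,w\rangle_{\mathbb{C}^k}},\qquad (z,w)\in B_k\times B_k,$$ be the Drury-Arveson kernel, and set $$K^{(\mu)}(z,w)=\int_{\partial B_k}\overline{\frac{1}{1-\langle b,z\rangle_{\mathbb{C}^k}}}\;\frac{1}{1-\langle b,w\rangle_{\mathbb{C}^k}}\,d\mu(b),\qquad (z,w)\in B_k\times B_k.$$ Then $K^{(\mu)}\ll K$.
   Context: The inner product on $\mathbb{C}^k$ is linear in the second variable: $\langle z,w\rangle_{\mathbb{C}^k}=\sum_{j=1}^k\overline{z}_jw_j$. $U_k$ is the group of unitary $k\times k$ matrices, $\partial B_k\simeq U_k/U_{k-1}$, and $\mu=\mu_k=\lambda_k\circ\pi_k^{-1}$ is the image of the normalized Haar measure $\lambda_k$ on $U_k$ under the quotient map $\pi_k:U_k\to U_k/U_{k-1}\simeq\partial B_k$ (so $\mu$ is a $U_k$-invariant probability measure on $\partial B_k$). For positive definite kernels $K,L$ on $X\times X$, $K\ll L$ means: for all finite subsets $\{x_i\}_{i=1}^N\subset X$ and all $c_i\in\mathbb{C}$, $\sum_{i}\sum_{j}\overline{c}_ic_jK(x_i,x_j)\le\sum_{i}\sum_{j}\overline{c}_ic_jL(x_i,x_j)$.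 *)

theory Defs
  imports "HOL-Analysis.Analysis" "HOL-Probability.Probability_Measure"
begin

text \<open>
  The space of complex \<open>k\<close>-vectors is \<open>complex ^ 'n\<close> with \<open>k = CARD('n) \<ge> 1\<close>. The
  library norm on it is the Hermitian norm, so \<open>ball 0 1\<close> and \<open>sphere 0 1\<close> are the
  complex unit ball and its boundary:
\<close>

lemma unit_ball_iff: "z \<in> ball 0 1 \<longleftrightarrow> (\<Sum>i\<in>UNIV. (cmod (z $ i))\<^sup>2) < 1"
  for z :: "complex ^ 'n"
  by (simp add: norm_vec_def L2_set_def)

lemma unit_sphere_iff: "z \<in> sphere 0 1 \<longleftrightarrow> (\<Sum>i\<in>UNIV. (cmod (z $ i))\<^sup>2) = 1"
  for z :: "complex ^ 'n"
  by (simp add: norm_vec_def L2_set_def)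

text \<open>
  The library's \<open>inner\<close> on \<open>complex ^ 'n\<close> is only the real part of the Hermitian
  product below, which is linear in its second argument.
\<close>

definition cinner :: "complex ^ 'n \<Rightarrow> complex ^ 'n \<Rightarrow> complex" where
  "cinner z w = (\<Sum>j\<in>UNIV. cnj (z $ j) * w $ j)"

definition conj_transpose :: "complex ^ 'n ^ 'n \<Rightarrow> complex ^ 'n ^ 'n" where
  "conj_transpose U = map_matrix cnj (transpose U)"

definition unitary_group :: "(complex ^ 'n ^ 'n) set" where
  "unitary_group = {U. conj_transpose U ** U = mat 1 \<and> U ** conj_transpose U = mat 1}"

text \<open>
  The normalized measure on the unit sphere that is invariant under the unitary group.
  These conditions determine it uniquely, the action being transitive.
\<close>

definition normalized_unitary_invariant :: "(complex ^ 'n) measure \<Rightarrow> bool" where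
  "normalized_unitary_invariant \<mu> \<longleftrightarrow>
     sets \<mu> = sets (restrict_space borel (sphere 0 1)) \<and>
     prob_space \<mu> \<and>
     (\<forall>U\<in>unitary_group. distr \<mu> \<mu> (\<lambda>b. U *v b) = \<mu>)"

text \<open>
  The order on \<open>complex\<close> is that of \<open>HOL-Library.Complex_Order\<close>: \<open>a \<le> b\<close> means that
  \<open>b - a\<close> is a nonnegative real.
\<close>

definition positive_definite_on :: "'a set \<Rightarrow> ('a \<Rightarrow> 'a \<Rightarrow> complex) \<Rightarrow> bool" where
  "positive_definite_on X K \<longleftrightarrow>
     (\<forall>F c. finite F \<and> F \<subseteq> X \<longrightarrow> 0 \<le> (\<Sum>x\<in>F. \<Sum>y\<in>F. cnj (c x) * c y * K x y))"

text \<open>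
  \<open>K \<ll> L\<close> on \<open>X\<close>, a relation between positive definite kernels.
\<close>

definition kernel_le_on ::
    "'a set \<Rightarrow> ('a \<Rightarrow> 'a \<Rightarrow> complex) \<Rightarrow> ('a \<Rightarrow> 'a \<Rightarrow> complex) \<Rightarrow> bool" where
  "kernel_le_on X K L \<longleftrightarrow>
     positive_definite_on X K \<and> positive_definite_on X L \<and>
     (\<forall>F c. finite F \<and> F \<subseteq> X \<longrightarrow>
        (\<Sum>x\<in>F. \<Sum>y\<in>F. cnj (c x) * c y * K x y) \<le> (\<Sum>x\<in>F. \<Sum>y\<in>F. cnj (c x) * c y * L x y))"

definition drury_arveson :: "complex ^ 'n \<Rightarrow> complex ^ 'n \<Rightarrow> complex" where
  "drury_arveson z w = 1 / (1 - cinner z w)"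

definition boundary_kernel ::
    "(complex ^ 'n) measure \<Rightarrow> complex ^ 'n \<Rightarrow> complex ^ 'n \<Rightarrow> complex" where
  "boundary_kernel \<mu> z w =
     (LINT b|\<mu>. cnj (1 / (1 - cinner b z)) * (1 / (1 - cinner b w)))"

text \<open>
  The conditions in \<open>normalized_unitary_invariant\<close> hold for the image of normalized Haar
  measure under the orbit map of a basis vector, whose fibres are the cosets of its
  stabilizer, a copy of the unitary group in dimension \<open>k - 1\<close>.
\<close>

definition normalized_haar :: "(complex ^ 'n ^ 'n) measure \<Rightarrow> bool" where
  "normalized_haar \<nu> \<longleftrightarrow>
     sets \<nu> = sets (restrict_space borel unitary_group) \<and>
     prob_space \<nu> \<and>
     (\<forall>V\<in>unitary_group. distr \<nu> \<nu> (\<lambda>U. V ** U) = \<nu>)"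

lemma cinner_self: "cinner z z = complex_of_real ((norm z)\<^sup>2)"
proof -
  have "cnj a * a = complex_of_real ((cmod a)\<^sup>2)" for a
    using complex_norm_square[of a] by (simp add: mult.commute)
  then show ?thesis
    by (simp add: cinner_def norm_vec_def L2_set_def sum_nonneg)
qed

lemma cinner_matrix: "cinner (A *v z) w = cinner z (conj_transpose A *v w)"
  unfolding cinner_def conj_transpose_def
  by (simp add: matrix_vector_mult_def transpose_def sum_distrib_left sum_distrib_right
        mult.assoc mult.left_commute)
    (rule sum.swap)

lemma norm_unitary: "U \<in> unitary_group \<Longrightarrow> norm (U *v z) = norm z"
proof -
  assume U: "U \<in> unitary_group"
  have "cinner (U *v z) (U *v z) = cinner z z"
    using U by (simp add: cinner_matrix unitary_group_def matrix_vector_mul_assoc)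
  then have "(norm (U *v z))\<^sup>2 = (norm z)\<^sup>2"
    unfolding cinner_self of_real_eq_iff .
  then show ?thesis by simp
qed

lemma unitary_group_mult:
  assumes "U \<in> unitary_group" "V \<in> unitary_group"
  shows "U ** V \<in> unitary_group"
proof -
  have ct: "conj_transpose (U ** V) = conj_transpose V ** conj_transpose U"
    by (simp add: conj_transpose_def vec_eq_iff matrix_matrix_mult_def transpose_def mult.commute)
  have "conj_transpose V ** conj_transpose U ** (U ** V)
      = conj_transpose V ** (conj_transpose U ** U) ** V"
    "U ** V ** (conj_transpose V ** conj_transpose U)
      = U ** (V ** conj_transpose V) ** conj_transpose U"
    by (simp_all add: matrix_mul_assoc)
  then show ?thesis
    using assms by (simp add: unitary_group_def ct)
qed

lemma haar_image_normalized_unitary_invariant: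
  fixes \<nu> :: "(complex ^ 'n ^ 'n) measure"
  assumes "normalized_haar \<nu>"
  shows "normalized_unitary_invariant
    (distr \<nu> (restrict_space borel (sphere 0 1)) (\<lambda>U. U *v axis i 1))"
proof -
  let ?S = "restrict_space borel (sphere 0 1) :: (complex ^ 'n) measure"
  let ?p = "\<lambda>U :: complex ^ 'n ^ 'n. U *v axis i 1"
  have sets: "sets \<nu> = sets (restrict_space borel unitary_group)"
    and inv: "\<And>V. V \<in> unitary_group \<Longrightarrow> distr \<nu> \<nu> (\<lambda>U. V ** U) = \<nu>"
    using assms by (auto simp: normalized_haar_def)
  interpret prob_space \<nu> using assms by (simp add: normalized_haar_def)
  have cmv: "continuous_on UNIV (\<lambda>U :: complex ^ 'n ^ 'n. U *v b)" for b
    unfolding matrix_vector_mult_def by (intro continuous_intros)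
  have cvv: "continuous_on UNIV (\<lambda>b :: complex ^ 'n. U *v b)" for U
    unfolding matrix_vector_mult_def by (intro continuous_intros)
  have cmm: "continuous_on UNIV (\<lambda>U :: complex ^ 'n ^ 'n. V ** U)" for V
    unfolding matrix_matrix_mult_def by (intro continuous_intros)
  have p: "?p \<in> measurable \<nu> ?S"
    unfolding measurable_cong_sets[OF sets refl]
    by (intro measurable_restrict_space3 borel_measurable_continuous_onI cmv)
      (auto simp: norm_unitary)
  have m: "(\<lambda>b. V *v b) \<in> measurable ?S ?S" if "V \<in> unitary_group" for V
    by (intro measurable_restrict_space3 borel_measurable_continuous_onI cvv)
      (auto simp: norm_unitary that)
  have l: "(\<lambda>U. V ** U) \<in> measurable \<nu> \<nu>" if "V \<in> unitary_group" for V
    unfolding measurable_cong_sets[OF sets sets]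
    by (intro measurable_restrict_space3 borel_measurable_continuous_onI cmm)
      (auto simp: unitary_group_mult that)
  have "distr (distr \<nu> ?S ?p) (distr \<nu> ?S ?p) (\<lambda>b. V *v b) = distr \<nu> ?S ?p"
    if V: "V \<in> unitary_group" for V
  proof -
    have "distr (distr \<nu> ?S ?p) (distr \<nu> ?S ?p) (\<lambda>b. V *v b)
        = distr (distr \<nu> ?S ?p) ?S (\<lambda>b. V *v b)"
      by (rule distr_cong) auto
    also have "\<dots> = distr \<nu> ?S (\<lambda>U. V *v ?p U)"
      by (simp add: distr_distr[OF m[OF V] p] o_def)
    also have "\<dots> = distr (distr \<nu> \<nu> (\<lambda>U. V ** U)) ?S ?p"
      by (simp add: distr_distr[OF p l[OF V]] o_def matrix_vector_mul_assoc)
    finally show ?thesis by (simp add: inv[OF V])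
  qed
  then show ?thesis
    using prob_space_distr[OF p] by (simp add: normalized_unitary_invariant_def)
qed

end

theory Submission
  imports Defs
begin

text \<open>
  Only the invariance of \<open>\<mu>\<close> under the scalars of modulus one matters. For
  \<open>f b = (\<Sum>y. c y / (1 - \<langle>b, y\<rangle>))\<close> the homogeneous parts \<open>g\<^sub>n b = (\<Sum>y. c y * \<langle>b, y\<rangle>\<^sup>n)\<close> are
  pairwise orthogonal in \<open>L\<^sup>2(\<mu>)\<close>, so \<open>\<integral> \<bar>f\<bar>\<^sup>2 = (\<Sum>n. \<integral> \<bar>g\<^sub>n\<bar>\<^sup>2)\<close>. Since \<open>g\<^sub>n b\<close> is the inner product
  of the \<open>n\<close>-th tensor power of the unit vector \<open>b\<close> with the combination, with coefficients \<open>c y\<close>,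
  of the tensor powers of the \<open>y\<close>, Cauchy-Schwarz bounds \<open>\<bar>g\<^sub>n b\<bar>\<^sup>2\<close> pointwise by
  \<open>\<Sum>x y. cnj (c x) * c y * \<langle>x, y\<rangle>\<^sup>n\<close>. Summing over \<open>n\<close> gives the Drury-Arveson form.
\<close>

section \<open>The Hermitian product and scalar unitary matrices\<close>

lemma norm_cinner_le: "cmod (cinner z w) \<le> norm z * norm w"
proof -
  have "cmod (cinner z w) \<le> (\<Sum>j\<in>UNIV. \<bar>cmod (z $ j)\<bar> * \<bar>cmod (w $ j)\<bar>)"
    unfolding cinner_def by (rule order_trans[OF norm_sum]) (simp add: norm_mult)
  also have "\<dots> \<le> norm z * norm w"
    unfolding norm_vec_def by (rule L2_set_mult_ineq)
  finally show ?thesis .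
qed

lemma continuous_on_cinner [continuous_intros]:
  assumes "continuous_on S f"
  shows "continuous_on S (\<lambda>x. cinner (f x) w)"
  unfolding cinner_def by (intro continuous_intros assms)

lemma cinner_mat_mult: "cinner (mat u *v z) w = cnj u * cinner z w"
proof -
  have "(mat u *v z) $ j = u * z $ j" for j
    by (simp add: matrix_vector_mult_def mat_def if_distrib if_distribR cong: if_cong)
  then show ?thesis
    by (simp add: cinner_def sum_distrib_left mult.assoc)
qed

lemma mat_in_unitary_group:
  assumes "cmod u = 1"
  shows "(mat u :: complex ^ 'n ^ 'n) \<in> unitary_group"
proof -
  have "u * cnj u = 1" using assms by (simp add: complex_norm_square[symmetric])
  moreover have "conj_transpose (mat u :: complex ^ 'n ^ 'n) = mat (cnj u)"
    by (auto simp: conj_transpose_def vec_eq_iff transpose_def mat_def)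
  moreover have "(mat a :: complex ^ 'n ^ 'n) ** mat b = mat (a * b)" for a b
  proof -
    have "(\<Sum>k\<in>UNIV. (if i = k then a else 0) * (if k = j then b else 0))
        = (\<Sum>k\<in>UNIV. if i = k then a * (if k = j then b else 0) else 0)" for i j :: 'n
      by (intro sum.cong) auto
    then show ?thesis
      by (simp add: vec_eq_iff matrix_matrix_mult_def mat_def)
  qed
  ultimately show ?thesis
    by (simp add: unitary_group_def mult.commute)
qed

text \<open>In the partial order on \<open>complex\<close>, \<open>X n \<le> Y n\<close> forces
  equal imaginary parts, so these share one limit; the real parts are compared as usual.\<close>

lemma complex_LIMSEQ_le:
  fixes a b :: complex
  assumes "X \<longlonglongrightarrow> a" "Y \<longlonglongrightarrow> b" "\<And>n. X n \<le> Y n"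
  shows "a \<le> b"
proof -
  have "Re a \<le> Re b"
    by (rule LIMSEQ_le[OF tendsto_Re[OF assms(1)] tendsto_Re[OF assms(2)]])
      (use assms(3) in \<open>auto simp: less_eq_complex_def\<close>)
  moreover have "Im a = Im b"
  proof -
    have "(\<lambda>n. Im (X n)) = (\<lambda>n. Im (Y n))"
      using assms(3) by (auto simp: less_eq_complex_def)
    then show ?thesis
      using tendsto_Im[OF assms(1)] tendsto_Im[OF assms(2)] LIMSEQ_unique by metis
  qed
  ultimately show ?thesis by (simp add: less_eq_complex_def)
qed

section \<open>Pointwise bounds on the homogeneous parts\<close>

lemma cnj_mult_self: "cnj a * a = complex_of_real ((cmod a)\<^sup>2)"
  using complex_norm_square[of a] by (simp add: mult.commute)

lemma sum_cnj_mult_self: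
  "(\<Sum>x\<in>F. \<Sum>y\<in>F. cnj (c x) * c y) = complex_of_real ((cmod (\<Sum>x\<in>F. c x))\<^sup>2)"
  unfolding cnj_mult_self[symmetric] by (simp add: sum_product)

text \<open>The induction on the tensor power peels off one factor at a time, absorbing its coordinates
  into the coefficients.\<close>

lemma power_form_ge:
  fixes b :: "complex ^ 'n"
  assumes b: "norm b \<le> 1"
  shows "complex_of_real ((cmod (\<Sum>y\<in>F. c y * cinner b y ^ n))\<^sup>2)
    \<le> (\<Sum>x\<in>F. \<Sum>y\<in>F. cnj (c x) * c y * cinner x y ^ n)"
proof (induction n arbitrary: c)
  case 0
  then show ?case by (simp add: sum_cnj_mult_self)
next
  case (Suc n)
  \<comment> \<open>Each \<open>A j\<close> is a degree \<open>n\<close> sum with coefficients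
    \<open>c y * y $ j\<close>, hence of the form the induction hypothesis treats.\<close>
  define A where "A j = (\<Sum>y\<in>F. (c y * y $ j) * cinner b y ^ n)" for j
  have "(\<Sum>y\<in>F. c y * cinner b y ^ Suc n)
      = (\<Sum>y\<in>F. \<Sum>j\<in>UNIV. cnj (b $ j) * ((c y * y $ j) * cinner b y ^ n))"
    unfolding power_Suc cinner_def[of b]
    by (simp add: sum_distrib_left sum_distrib_right ac_simps)
  also have "\<dots> = (\<Sum>j\<in>UNIV. cnj (b $ j) * A j)"
    unfolding A_def sum_distrib_left by (rule sum.swap)
  finally have eq: "(\<Sum>y\<in>F. c y * cinner b y ^ Suc n) = cinner b (\<chi> j. A j)"
    by (simp add: cinner_def)
  \<comment> \<open>Cauchy-Schwarz is applied to the peeled factor alone;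
    \<open>norm b \<le> 1\<close> then leaves the sum of the squares of the
    \<open>A j\<close>.\<close>
  have "cmod (cinner b (\<chi> j. A j)) \<le> norm b * norm (\<chi> j. A j)"
    by (rule norm_cinner_le)
  also have "\<dots> \<le> norm (\<chi> j. A j)"
    using mult_right_mono[OF b, of "norm (\<chi> j. A j)"] by simp
  finally have "(cmod (cinner b (\<chi> j. A j)))\<^sup>2 \<le> (norm (\<chi> j. A j))\<^sup>2"
    by (rule power_mono) simp
  also have "\<dots> = (\<Sum>j\<in>UNIV. (cmod (A j))\<^sup>2)"
    by (simp add: norm_vec_def L2_set_def sum_nonneg)
  finally have "complex_of_real ((cmod (cinner b (\<chi> j. A j)))\<^sup>2)
      \<le> (\<Sum>j\<in>UNIV. complex_of_real ((cmod (A j))\<^sup>2))"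
    by (simp add: less_eq_complex_def)
  also have "\<dots> \<le> (\<Sum>j\<in>UNIV. \<Sum>x\<in>F. \<Sum>y\<in>F.
      cnj (c x * x $ j) * (c y * y $ j) * cinner x y ^ n)"
    unfolding A_def by (intro sum_mono Suc.IH)
  also have "\<dots> = (\<Sum>x\<in>F. \<Sum>y\<in>F. \<Sum>j\<in>UNIV.
      cnj (c x * x $ j) * (c y * y $ j) * cinner x y ^ n)"
    by (subst sum.swap, intro sum.cong refl) (rule sum.swap)
  also have "\<dots> = (\<Sum>x\<in>F. \<Sum>y\<in>F. cnj (c x) * c y * cinner x y ^ Suc n)"
  proof (intro sum.cong refl)
    fix x y
    show "(\<Sum>j\<in>UNIV. cnj (c x * x $ j) * (c y * y $ j) * cinner x y ^ n)
        = cnj (c x) * c y * cinner x y ^ Suc n"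
      unfolding power_Suc cinner_def[of x y]
      by (simp only: sum_distrib_left sum_distrib_right complex_cnj_mult ac_simps)
  qed
  finally show ?case unfolding eq .
qed

text \<open>Cauchy-Schwarz puts \<open>cinner x y\<close> inside the unit disc, so every entry of
  the form is a geometric series.\<close>

lemma drury_arveson_form_tendsto:
  assumes "F \<subseteq> ball 0 1"
  shows "(\<lambda>N. \<Sum>n<N. \<Sum>x\<in>F. \<Sum>y\<in>F. cnj (c x) * c y * cinner x y ^ n)
    \<longlonglongrightarrow> (\<Sum>x\<in>F. \<Sum>y\<in>F. cnj (c x) * c y * drury_arveson x y)"
proof -
  have "(\<lambda>n. cnj (c x) * c y * cinner x y ^ n) sums (cnj (c x) * c y * drury_arveson x y)"
    if "x \<in> F" "y \<in> F" for x y
  proof -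
    have "norm x < 1" "norm y < 1" using that assms by (auto simp: subset_iff)
    then have "norm x * norm y < 1"
      using mult_strict_mono'[of "norm x" 1 "norm y" 1] by simp
    then have "cmod (cinner x y) < 1"
      using norm_cinner_le[of x y] by linarith
    then show ?thesis
      unfolding drury_arveson_def by (intro sums_mult geometric_sums)
  qed
  then show ?thesis
    unfolding sums_def[symmetric] by (intro sums_sum)
qed

section \<open>Integration over the sphere\<close>

context
  fixes \<mu> :: "(complex ^ 'n) measure"
  assumes \<mu>: "normalized_unitary_invariant \<mu>"
begin

lemma sets_\<mu>: "sets \<mu> = sets (restrict_space borel (sphere 0 1))"
  and prob_space_\<mu>: "prob_space \<mu>"
  and distr_\<mu>: "U \<in> unitary_group \<Longrightarrow> distr \<mu> \<mu> (\<lambda>b. U *v b) = \<mu>"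
  using \<mu> by (auto simp: normalized_unitary_invariant_def)

lemma space_\<mu>: "space \<mu> = sphere 0 1"
  using sets_eq_imp_space_eq[OF sets_\<mu>] by (simp add: space_restrict_space)

interpretation prob_space \<mu> by (rule prob_space_\<mu>)

lemma borel_measurable_sphere:
  fixes f :: "complex ^ 'n \<Rightarrow> complex"
  assumes "continuous_on (sphere 0 1) f"
  shows "f \<in> borel_measurable \<mu>"
  unfolding measurable_cong_sets[OF sets_\<mu> refl]
  by (rule borel_measurable_continuous_on_restrict[OF assms])

text \<open>A continuous function on the compact sphere is bounded, and \<open>\<mu>\<close> is
  finite.\<close>

lemma integrable_sphere:
  fixes f :: "complex ^ 'n \<Rightarrow> complex"
  assumes "continuous_on (sphere 0 1) f"
  shows "integrable \<mu> f"
proof -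
  have "bounded (f ` sphere 0 1)"
    by (intro compact_imp_bounded compact_continuous_image assms compact_sphere)
  then obtain B where "\<And>x. x \<in> sphere 0 1 \<Longrightarrow> cmod (f x) \<le> B"
    unfolding bounded_iff by blast
  then show ?thesis
    by (intro integrable_const_bound[where B = B] borel_measurable_sphere assms AE_I2)
      (auto simp: space_\<mu>)
qed

text \<open>Change of variables along \<open>b \<mapsto> u * b\<close>, a unitary map that preserves
  \<open>\<mu>\<close>.\<close>

lemma integral_rotate:
  fixes f :: "complex ^ 'n \<Rightarrow> complex"
  assumes "continuous_on (sphere 0 1) f" "cmod u = 1"
  shows "(LINT b|\<mu>. f (mat u *v b)) = (LINT b|\<mu>. f b)"
proof -
  let ?U = "mat u :: complex ^ 'n ^ 'n"
  have U: "?U \<in> unitary_group" by (rule mat_in_unitary_group[OF assms(2)])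
  have "continuous_on UNIV (\<lambda>b :: complex ^ 'n. ?U *v b)"
    unfolding matrix_vector_mult_def by (intro continuous_intros)
  then have "(\<lambda>b. ?U *v b) \<in> measurable \<mu> \<mu>"
    unfolding measurable_cong_sets[OF sets_\<mu> sets_\<mu>]
    by (intro measurable_restrict_space3 borel_measurable_continuous_onI)
      (auto simp: norm_unitary U)
  from integral_distr[OF this borel_measurable_sphere[OF assms(1)]]
  show ?thesis by (simp add: distr_\<mu>[OF U])
qed

text \<open>A single well-chosen rotation reverses the sign of the integrand, so the integral equals
  its own negative.\<close>

lemma orthogonal_homogeneous:
  fixes g h :: "complex ^ 'n \<Rightarrow> complex"
  assumes "continuous_on (sphere 0 1) g" "continuous_on (sphere 0 1) h"
    and g: "\<And>u b. g (mat u *v b) = cnj u ^ n * g b"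
    and h: "\<And>u b. h (mat u *v b) = cnj u ^ m * h b"
    and "n < m"
  shows "(LINT b|\<mu>. cnj (g b) * h b) = 0"
proof -
  \<comment> \<open>A unimodular root of \<open>-1\<close> of order \<open>m - n\<close>, which is
    positive because \<open>n < m\<close>.\<close>
  define u where "u = cis (pi / real (m - n))"
  have u: "u * cnj u = 1" by (simp add: u_def cis_cnj cis_mult)
  have "u ^ (m - n) = -1"
    unfolding u_def Complex.DeMoivre using \<open>n < m\<close> by simp
  then have "cnj u ^ (m - n) = -1"
    by (metis complex_cnj_minus complex_cnj_one complex_cnj_power)
  \<comment> \<open>The product is \<open>(u * cnj u) ^ n * cnj u ^ (m - n)\<close>, and its first
    factor is 1.\<close>
  then have "u ^ n * cnj u ^ m = -1"
    using \<open>n < m\<close> power_add[of "cnj u" n "m - n"] u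
    by (simp add: power_mult_distrib[symmetric] flip: mult.assoc)
  then have "cnj (g (mat u *v b)) * h (mat u *v b) = - (cnj (g b) * h b)" for b
    unfolding g h by (simp add: algebra_simps)
  moreover have "(LINT b|\<mu>. cnj (g (mat u *v b)) * h (mat u *v b)) = (LINT b|\<mu>. cnj (g b) * h b)"
    by (rule integral_rotate) (auto intro!: continuous_intros assms simp: u_def)
  ultimately show ?thesis by simp
qed

lemma boundary_form_eq:
  assumes "finite F" "F \<subseteq> ball 0 1"
  shows "(\<Sum>x\<in>F. \<Sum>y\<in>F. cnj (c x) * c y * boundary_kernel \<mu> x y)
    = (LINT b|\<mu>. cnj (\<Sum>y\<in>F. c y * (1 / (1 - cinner b y))) * (\<Sum>y\<in>F. c y * (1 / (1 - cinner b y))))"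
proof -
  \<comment> \<open>On the sphere \<open>cmod (cinner b y) \<le> norm y < 1\<close>, so the
    integrands have no poles there.\<close>
  have ne: "1 - cinner b y \<noteq> 0" if "b \<in> sphere 0 1" "y \<in> F" for b y
    using norm_cinner_le[of b y] that assms(2) by (auto simp: subset_iff)
  have int: "integrable \<mu> (\<lambda>b. cnj (1 / (1 - cinner b x)) * (1 / (1 - cinner b y)))"
    if "x \<in> F" "y \<in> F" for x y
    by (intro integrable_sphere continuous_intros ballI ne that)
  have "(\<Sum>x\<in>F. \<Sum>y\<in>F. cnj (c x) * c y * boundary_kernel \<mu> x y)
    = (LINT b|\<mu>. (\<Sum>x\<in>F. \<Sum>y\<in>F. cnj (c x) * c y *
        (cnj (1 / (1 - cinner b x)) * (1 / (1 - cinner b y)))))"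
  proof -
    define h where "h x y b = cnj (1 / (1 - cinner b x)) * (1 / (1 - cinner b y))"
      for x y b :: "complex ^ 'n"
    have "integrable \<mu> (h x y)" if "x \<in> F" "y \<in> F" for x y
      using int[OF that] unfolding h_def .
    then show ?thesis
      unfolding boundary_kernel_def h_def[symmetric]
      by (simp add: Bochner_Integration.integral_sum)
  qed
  also have "\<dots> = (LINT b|\<mu>. cnj (\<Sum>y\<in>F. c y * (1 / (1 - cinner b y))) *
      (\<Sum>y\<in>F. c y * (1 / (1 - cinner b y))))"
    unfolding cnj_sum sum_product by (simp add: ac_simps)
  finally show ?thesis .
qed

text \<open>Expanding the square, orthogonality removes the mixed degrees, and the pointwise bound
  controls each remaining degree.\<close>

lemma integral_partial_sum_le:
  "(LINT b|\<mu>. cnj (\<Sum>n<N. \<Sum>y\<in>F. c y * cinner b y ^ n) * (\<Sum>n<N. \<Sum>y\<in>F. c y * cinner b y ^ n))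
    \<le> (\<Sum>n<N. \<Sum>x\<in>F. \<Sum>y\<in>F. cnj (c x) * c y * cinner x y ^ n)"
proof -
  define g where "g n b = (\<Sum>y\<in>F. c y * cinner b y ^ n)" for n and b :: "complex ^ 'n"
  have cont: "continuous_on S (g n)" for S n
    unfolding g_def by (intro continuous_intros)
  have hom: "g n (mat u *v b) = cnj u ^ n * g n b" for n u b
    by (simp add: g_def cinner_mat_mult power_mult_distrib sum_distrib_left ac_simps)
  have int: "integrable \<mu> (\<lambda>b. cnj (g n b) * g m b)" for n m
    by (intro integrable_sphere continuous_intros cont)
  have orth: "(LINT b|\<mu>. cnj (g n b) * g m b) = 0" if "n \<noteq> m" for n m
  proof (cases "n < m")
    case True
    then show ?thesis by (intro orthogonal_homogeneous[OF cont cont hom hom])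
  next
    case False
    \<comment> \<open>Here \<open>m < n\<close>: the roles are exchanged and the vanishing integral
      is conjugated.\<close>
    then have "(LINT b|\<mu>. cnj (g m b) * g n b) = 0"
      using that by (intro orthogonal_homogeneous[OF cont cont hom hom]) auto
    then have "cnj (LINT b|\<mu>. cnj (g m b) * g n b) = 0" by simp
    then show ?thesis
      unfolding Bochner_Integration.integral_cnj[symmetric] by (simp add: mult.commute)
  qed
  have diag: "(LINT b|\<mu>. cnj (g n b) * g n b)
      \<le> (\<Sum>x\<in>F. \<Sum>y\<in>F. cnj (c x) * c y * cinner x y ^ n)" (is "_ \<le> ?Q") for n
  proof -
    have le: "complex_of_real ((cmod (g n b))\<^sup>2) \<le> ?Q" if "norm b \<le> 1" for b
      unfolding g_def by (rule power_form_ge[OF that])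
    \<comment> \<open>Comparability with a real number makes \<open>?Q\<close> real; the point 0
      serves as one admissible \<open>b\<close>.\<close>
    have "Im ?Q = 0"
      using le[of 0] by (simp add: less_eq_complex_def del: Im_sum)
    \<comment> \<open>Total mass 1 turns the constant pointwise bound into the same bound for the
      integral.\<close>
    moreover have "(LINT b|\<mu>. (cmod (g n b))\<^sup>2) \<le> Re ?Q"
    proof (rule integral_le_const)
      show "integrable \<mu> (\<lambda>b. (cmod (g n b))\<^sup>2)"
        using int[of n n] unfolding cnj_mult_self complex_of_real_integrable_eq .
      show "AE b in \<mu>. (cmod (g n b))\<^sup>2 \<le> Re ?Q"
        using le by (intro AE_I2) (auto simp: space_\<mu> less_eq_complex_def simp del: Re_sum)
    qed
    ultimately show ?thesis
      by (simp add: cnj_mult_self less_eq_complex_def del: Re_sum Im_sum of_real_power)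
  qed
  have "(LINT b|\<mu>. cnj (\<Sum>n<N. g n b) * (\<Sum>n<N. g n b))
      = (LINT b|\<mu>. (\<Sum>n<N. \<Sum>m<N. cnj (g n b) * g m b))"
    by (simp add: sum_product)
  also have "\<dots> = (\<Sum>n<N. \<Sum>m<N. LINT b|\<mu>. cnj (g n b) * g m b)"
    using int by (simp add: Bochner_Integration.integral_sum)
  also have "\<dots> = (\<Sum>n<N. \<Sum>m<N. if n = m then LINT b|\<mu>. cnj (g n b) * g n b else 0)"
    by (intro sum.cong refl) (simp add: orth)
  also have "\<dots> = (\<Sum>n<N. LINT b|\<mu>. cnj (g n b) * g n b)"
    by simp
  also have "\<dots> \<le> (\<Sum>n<N. \<Sum>x\<in>F. \<Sum>y\<in>F. cnj (c x) * c y * cinner x y ^ n)"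
    by (intro sum_mono diag)
  finally show ?thesis unfolding g_def .
qed

text \<open>Dominated convergence: the geometric expansions converge pointwise on the sphere and
  their partial sums are uniformly bounded.\<close>

lemma integral_partial_sum_tendsto:
  assumes "F \<subseteq> ball 0 1"
  shows "(\<lambda>N. LINT b|\<mu>. cnj (\<Sum>n<N. \<Sum>y\<in>F. c y * cinner b y ^ n) *
      (\<Sum>n<N. \<Sum>y\<in>F. c y * cinner b y ^ n))
    \<longlonglongrightarrow> (LINT b|\<mu>. cnj (\<Sum>y\<in>F. c y * (1 / (1 - cinner b y))) *
      (\<Sum>y\<in>F. c y * (1 / (1 - cinner b y))))"
proof -
  define f where "f N b = (\<Sum>n<N. \<Sum>y\<in>F. c y * cinner b y ^ n)" for N and b :: "complex ^ 'n"
  define f' where "f' b = (\<Sum>y\<in>F. c y * (1 / (1 - cinner b y)))" for b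
  \<comment> \<open>Since \<open>cmod (cinner b y) \<le> norm y\<close> on the sphere, summing the
    geometric series of ratio \<open>norm y\<close> bounds all partial sums at once.\<close>
  define B where "B = (\<Sum>y\<in>F. cmod (c y) * (1 / (1 - norm y)))"
  have cinner_le: "cmod (cinner b y) \<le> norm y" if "b \<in> sphere 0 1" for b y :: "complex ^ 'n"
    using norm_cinner_le[of b y] that by simp
  have y1: "norm y < 1" if "y \<in> F" for y
    using assms that by auto
  have lim: "(\<lambda>N. f N b) \<longlonglongrightarrow> f' b" if b: "b \<in> sphere 0 1" for b
    unfolding f_def f'_def sums_def[symmetric]
    using cinner_le[OF b] y1 by (intro sums_sum sums_mult geometric_sums) (rule le_less_trans)
  have bound: "cmod (f N b) \<le> B" if b: "b \<in> sphere 0 1" for N b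
  proof -
    have "cmod (f N b) \<le> (\<Sum>n<N. \<Sum>y\<in>F. cmod (c y) * norm y ^ n)"
      unfolding f_def
      by (intro order_trans[OF norm_sum] sum_mono)
        (auto simp: norm_mult norm_power intro!: mult_left_mono power_mono cinner_le b)
    also have "\<dots> = (\<Sum>y\<in>F. cmod (c y) * (\<Sum>n<N. norm y ^ n))"
      unfolding sum_distrib_left by (rule sum.swap)
    also have "\<dots> \<le> B"
      unfolding B_def
    proof (intro sum_mono mult_left_mono norm_ge_zero)
      fix y assume "y \<in> F"
      then have "(\<lambda>n. norm y ^ n) sums (1 / (1 - norm y))"
        using y1 by (intro geometric_sums) simp
      then show "(\<Sum>n<N. norm y ^ n) \<le> 1 / (1 - norm y)"
        using sum_le_suminf[of "\<lambda>n. norm y ^ n" "{..<N}"] by (auto simp: sums_iff)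
    qed
    finally show ?thesis .
  qed
  have meas_f: "f N \<in> borel_measurable \<mu>" for N
    unfolding f_def by (intro borel_measurable_sphere continuous_intros)
  have meas_f': "f' \<in> borel_measurable \<mu>"
    by (rule borel_measurable_LIMSEQ_metric[OF meas_f lim]) (simp add: space_\<mu>)
  have "(\<lambda>N. LINT b|\<mu>. cnj (f N b) * f N b) \<longlonglongrightarrow> (LINT b|\<mu>. cnj (f' b) * f' b)"
  proof (rule integral_dominated_convergence[where w = "\<lambda>_. B\<^sup>2"])
    show "AE b in \<mu>. (\<lambda>N. cnj (f N b) * f N b) \<longlonglongrightarrow> cnj (f' b) * f' b"
      by (intro AE_I2 tendsto_intros lim) (auto simp: space_\<mu>)
    show "AE b in \<mu>. cmod (cnj (f N b) * f N b) \<le> B\<^sup>2" for N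
      using bound by (intro AE_I2)
        (auto simp: space_\<mu> norm_mult power2_eq_square intro!: mult_mono
          intro: order_trans[OF norm_ge_zero])
  qed (use meas_f meas_f' in \<open>auto intro!: borel_measurable_times
      measurable_compose[OF _ borel_measurable_continuous_onI[OF continuous_on_cnj[OF continuous_on_id]]]\<close>)
  then show ?thesis unfolding f_def f'_def .
qed

end

theorem theorem4p2:
  fixes \<mu> :: "(complex ^ 'n) measure"
  assumes "normalized_unitary_invariant \<mu>"
  shows "kernel_le_on (ball 0 1) (boundary_kernel \<mu>) drury_arveson"
proof -
  have le: "(\<Sum>x\<in>F. \<Sum>y\<in>F. cnj (c x) * c y * boundary_kernel \<mu> x y)
      \<le> (\<Sum>x\<in>F. \<Sum>y\<in>F. cnj (c x) * c y * drury_arveson x y)"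
    if "finite F \<and> F \<subseteq> ball 0 1" for F c
    unfolding boundary_form_eq[OF assms conjunct1[OF that] conjunct2[OF that]]
    by (rule complex_LIMSEQ_le[OF integral_partial_sum_tendsto[OF assms conjunct2[OF that]]
          drury_arveson_form_tendsto[OF conjunct2[OF that]] integral_partial_sum_le[OF assms]])
  \<comment> \<open>The form is the integral of a squared modulus.\<close>
  have nonneg: "0 \<le> (\<Sum>x\<in>F. \<Sum>y\<in>F. cnj (c x) * c y * boundary_kernel \<mu> x y)"
    if "finite F \<and> F \<subseteq> ball 0 1" for F c
    unfolding boundary_form_eq[OF assms conjunct1[OF that] conjunct2[OF that]] cnj_mult_self
    by (simp add: less_eq_complex_def del: of_real_power)
  have "positive_definite_on (ball 0 1) (boundary_kernel \<mu>)"
    unfolding positive_definite_on_def by (intro allI impI nonneg)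
  \<comment> \<open>The Drury-Arveson form dominates the nonnegative boundary form, so it inherits
    its sign.\<close>
  moreover have "positive_definite_on (ball 0 1) (drury_arveson :: complex ^ 'n \<Rightarrow> _)"
    unfolding positive_definite_on_def by (intro allI impI order_trans[OF nonneg le])
  ultimately show ?thesis
    unfolding kernel_le_on_def by (intro conjI) (assumption | intro allI impI le)+
qed

end
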